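(* Let $n\ge 16$ be even and let $W_{4,n}$ be the $4$-regular Kn\"odel graph. Then $W_{4,n}$ is $\gamma$-critical if and only if (i) $n=26$, or (ii) $n\ge 22$ and $n\equiv 2\pmod{10}$, or (iii) $n\ge 38$ and $n\equiv 8\pmod{10}$.
   Context: For an even integer $n\ge 2$ and $1\le\Delta\le\lfloor\log_2 n\rfloor$, the Kn\"odel graph $W_{\Delta,n}$ is the $\Delta$-regular bipartite graph on the $n$ vertices $(i,j)$, $i\in\{1,2\}$, $0\le j\le n/2-1$, in which for every $j$ the vertex $(1,j)$ is adjacent to the vertices $(2,(j+2^k-1)\bmod (n/2))$ for $k=0,1,\dots,\Delta-1$ (and there are no other edges). A set $D$ of vertices of a graph $G$ is dominating if every vertex not in $D$ is adjacent to a vertex of $D$; $\gamma(G)$ is the minimum size of a dominating set. A graph $G$ is $\gamma$-critical if $\gamma(G-u)<\gamma(G)$ for every vertex $u$ of $G$, where $G-u$ is the graph obtained by deleting $u$. *)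

theory Defs
  imports Main
begin

text \<open>Simple graphs given by a (finite) vertex set V and a symmetric adjacency
relation E; only edges between vertices of V are relevant.\<close>

definition dominating :: "'a set \<Rightarrow> ('a \<Rightarrow> 'a \<Rightarrow> bool) \<Rightarrow> 'a set \<Rightarrow> bool" where
  "dominating V E D \<longleftrightarrow> D \<subseteq> V \<and> (\<forall>v\<in>V - D. \<exists>d\<in>D. E d v)"

definition domination_number :: "'a set \<Rightarrow> ('a \<Rightarrow> 'a \<Rightarrow> bool) \<Rightarrow> nat" where
  "domination_number V E = (LEAST k. \<exists>D. dominating V E D \<and> card D = k)"

definition gamma_critical :: "'a set \<Rightarrow> ('a \<Rightarrow> 'a \<Rightarrow> bool) \<Rightarrow> bool" where
  "gamma_critical V E \<longleftrightarrow>
     (\<forall>u\<in>V. domination_number (V - {u}) E < domination_number V E)"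

definition knodel_vertices :: "nat \<Rightarrow> (nat \<times> nat) set" where
  "knodel_vertices n = {1,2} \<times> {0..<n div 2}"

definition knodel_adj :: "nat \<Rightarrow> nat \<Rightarrow> nat \<times> nat \<Rightarrow> nat \<times> nat \<Rightarrow> bool" where
  "knodel_adj \<Delta> n u v \<longleftrightarrow>
     (\<exists>j k. k < \<Delta> \<and> j < n div 2 \<and>
        ((u = (1, j) \<and> v = (2, (j + 2^k - 1) mod (n div 2))) \<or>
         (v = (1, j) \<and> u = (2, (j + 2^k - 1) mod (n div 2)))))"

end

theory Submission
  imports Defs
begin

text \<open>
  Write \<open>m = n / 2\<close>. The graph is the quotient by the period \<open>m\<close> of an infinite graph on two
  copies of the integers, and it is vertex-transitive. So it is \<open>\<gamma>\<close>-critical iff some set of fewer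
  than \<open>\<gamma>\<close> vertices dominates everything but one fixed vertex, the hole. If \<open>\<alpha>\<close> and \<open>\<beta>\<close> vertices
  are chosen on the two sides, their closed neighbourhoods hit the sides \<open>\<alpha> + 4\<beta>\<close> and \<open>\<beta> + 4\<alpha>\<close>
  times. Hence a small dominating set leaves only a small bounded excess on each side, and for each
  residue of \<open>m\<close> modulo 5 this pins down \<open>(\<alpha>, \<beta>)\<close> almost completely. In every case that counting
  does not settle, there is an anchor, namely either the hole or (if \<open>5\<beta> > m\<close>) two chosen vertices
  at distance at most 4 on one side, and a bounded search around the anchor shows that the given
  excess cannot suffice. The search looks only at a window of bounded size, hence it covers all
  large \<open>m\<close> at once; for the finitely many \<open>m\<close> shorter than the window it is run on the cyclic
  graph itself. The matching upper bounds are words with a repeated block of length 5. Inserting one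
  more block creates no new local configuration, so it suffices to check the first few words of each
  family.
\<close>

section \<open>Bounded search for coverings with small excess\<close>

definition covers :: "('a \<Rightarrow> 'a list) \<Rightarrow> 'a set \<Rightarrow> 'a \<Rightarrow> bool" where
  "covers N D v \<longleftrightarrow> (\<exists>d\<in>set (N v). d \<in> D)"

definition coverage :: "('a \<Rightarrow> 'a list) \<Rightarrow> 'a set \<Rightarrow> 'a \<Rightarrow> nat" where
  "coverage N D v = length (filter (\<lambda>d. d \<in> D) (N v))"

text \<open>By truncated subtraction, an uncovered vertex has excess 0.\<close>

definition excess :: "('a \<Rightarrow> 'a list) \<Rightarrow> 'a set \<Rightarrow> 'a set \<Rightarrow> nat" where
  "excess N D W = (\<Sum>v\<in>W. coverage N D v - 1)"

context
  fixes N :: "'a \<Rightarrow> 'a list"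
begin

definition cost :: "('a \<Rightarrow> bool) \<Rightarrow> 'a list \<Rightarrow> 'a \<Rightarrow> nat" where
  "cost A ins d = length (filter (covers N (set ins)) (filter A (N d)))"

context
  fixes A B :: "'a \<Rightarrow> bool"
begin

text \<open>The result \<open>True\<close> means that no set that contains \<open>ins\<close>, avoids \<open>outs\<close> and covers \<open>vs\<close>
  adds at most \<open>k\<close> and \<open>l\<close> to the excess of \<open>ins\<close> in the windows \<open>A\<close> and \<open>B\<close>. The nested
  conditionals and the separate \<open>infeasible_branch\<close> in place of a \<open>let\<close> keep evaluation by rewriting
  from exploring dead branches.\<close>

function (sequential) infeasible and infeasible_choosing and infeasible_branch where
  "infeasible k l [] ins outs = False"
| "infeasible k l (v # vs) ins outs =
    (if covers N (set ins) v then infeasible k l vs ins outs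
     else infeasible_choosing k l vs (N v) ins outs)"
| "infeasible_choosing k l vs [] ins outs = True"
| "infeasible_choosing k l vs (d # ds) ins outs =
    (if d \<in> set outs then infeasible_choosing k l vs ds ins outs
     else infeasible_branch k l vs d ds ins outs (cost A ins d) (cost B ins d))"
| "infeasible_branch k l vs d ds ins outs a b =
    (if a \<le> k \<and> b \<le> l
     then if infeasible (k - a) (l - b) vs (d # ins) outs
       then infeasible_choosing k l vs ds ins (d # outs) else False
     else infeasible_choosing k l vs ds ins (d # outs))"
  by pat_completeness auto
termination
  by (relation "inv_image (less_than <*lex*> less_than <*lex*> less_than)
    (\<lambda>x. case x of Inl (_, _, vs, _, _) \<Rightarrow> (length vs, 0, 0)
      | Inr (Inl (_, _, vs, ds, _, _)) \<Rightarrow> (length vs, 1, 2 * length ds)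
      | Inr (Inr (_, _, vs, _, ds, _, _, _, _)) \<Rightarrow> (length vs, 1, Suc (2 * length ds)))")
    auto

end

end

lemma covers_iff_coverage: "covers N D v \<longleftrightarrow> 0 < coverage N D v"
  by (auto simp: covers_def coverage_def filter_empty_conv)

lemma coverage_mono:
  assumes "C \<subseteq> D"
  shows "coverage N C v \<le> coverage N D v"
proof -
  have "length (filter (\<lambda>d. d \<in> C) ds) \<le> length (filter (\<lambda>d. d \<in> D) ds)" for ds
    using assms by (induction ds) auto
  then show ?thesis by (simp only: coverage_def)
qed

lemma excess_mono: "C \<subseteq> D \<Longrightarrow> excess N C W \<le> excess N D W"
  unfolding excess_def by (intro sum_mono diff_le_mono coverage_mono)

lemma coverage_insert:
  assumes "d \<notin> C"
  shows "coverage N (insert d C) v = coverage N C v + count_list (N v) d"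
proof -
  have "length (filter (\<lambda>x. x \<in> insert d C) xs)
      = length (filter (\<lambda>x. x \<in> C) xs) + count_list xs d" for xs
    using assms by (induction xs) auto
  then show ?thesis by (simp only: coverage_def)
qed

lemma excess_add_card_covered:
  assumes "finite W"
  shows "excess N D W + card {v \<in> W. covers N D v} = (\<Sum>v\<in>W. coverage N D v)"
proof -
  have "(coverage N D v - 1) + of_bool (covers N D v) = coverage N D v" for v
    by (simp add: covers_iff_coverage)
  then have "(\<Sum>v\<in>W. coverage N D v) = (\<Sum>v\<in>W. (coverage N D v - 1) + of_bool (covers N D v))"
    by simp
  with assms show ?thesis by (simp add: excess_def sum.distrib Int_def)
qed

locale closed_neighbourhoods =
  fixes V :: "'a set" and N :: "'a \<Rightarrow> 'a list"
  assumes nbrs_subset: "v \<in> V \<Longrightarrow> set (N v) \<subseteq> V"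
    and nbrs_sym: "\<lbrakk>v \<in> V; d \<in> set (N v)\<rbrakk> \<Longrightarrow> v \<in> set (N d)"
    and distinct_nbrs: "v \<in> V \<Longrightarrow> distinct (N v)"
begin

lemma excess_add_cost_le:
  assumes "d \<notin> set ins" "d \<in> V" "finite {v \<in> V. A v}"
  shows "excess N (set ins) {v \<in> V. A v} + cost N A ins d \<le> excess N (set (d # ins)) {v \<in> V. A v}"
proof -
  let ?W = "{v \<in> V. A v}"
  let ?newly = "\<lambda>v. v \<in> set (N d) \<and> covers N (set ins) v"
  have "cost N A ins d = card (set (filter (covers N (set ins)) (filter A (N d))))"
    unfolding cost_def using assms(2) by (subst distinct_card) (simp_all add: distinct_nbrs)
  also have "set (filter (covers N (set ins)) (filter A (N d))) = {v \<in> ?W. ?newly v}"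
    using nbrs_subset[OF assms(2)] by auto
  finally have cost: "cost N A ins d = (\<Sum>v\<in>?W. of_bool (?newly v))"
    using assms(3) by (simp add: Int_def)
  have "coverage N (set ins) v - 1 + of_bool (?newly v) \<le> coverage N (set (d # ins)) v - 1" for v
  proof (cases "?newly v")
    case True
    then have "0 < count_list (N v) d"
      using nbrs_sym[OF assms(2)] count_notin by (simp add: count_list_0_iff flip: neq0_conv)
    with True assms(1) show ?thesis by (simp add: coverage_insert covers_iff_coverage)
  next
    case False
    moreover have "coverage N (set ins) v - 1 \<le> coverage N (set (d # ins)) v - 1"
      by (intro diff_le_mono coverage_mono) auto
    ultimately show ?thesis by auto
  qed
  then show ?thesis
    unfolding cost excess_def by (simp only: sum.distrib[symmetric] sum_mono)
qed

definition completes ::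
  "('a \<Rightarrow> bool) \<Rightarrow> ('a \<Rightarrow> bool) \<Rightarrow> nat \<Rightarrow> nat \<Rightarrow> 'a list \<Rightarrow> 'a list \<Rightarrow> 'a set \<Rightarrow> bool" where
  "completes A B k l ins outs D \<longleftrightarrow> set ins \<subseteq> D \<and> set outs \<inter> D = {}
    \<and> excess N D {v \<in> V. A v} \<le> excess N (set ins) {v \<in> V. A v} + k
    \<and> excess N D {v \<in> V. B v} \<le> excess N (set ins) {v \<in> V. B v} + l"

lemma completes_in:
  assumes "completes A B k l ins outs D" "d \<in> D" "d \<notin> set ins" "d \<in> V"
    and "finite {v \<in> V. A v}" "finite {v \<in> V. B v}"
  defines "a \<equiv> cost N A ins d" and "b \<equiv> cost N B ins d"
  shows "a \<le> k \<and> b \<le> l \<and> completes A B (k - a) (l - b) (d # ins) outs D"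
proof -
  have ins: "set (d # ins) \<subseteq> D" using assms(1,2) by (auto simp: completes_def)
  show ?thesis
    using excess_add_cost_le[OF assms(3-5)] excess_add_cost_le[OF assms(3,4,6)] assms(1) ins
      excess_mono[OF ins, of N "{v \<in> V. A v}"] excess_mono[OF ins, of N "{v \<in> V. B v}"]
    unfolding completes_def a_def b_def by linarith
qed

lemma completes_out:
  "completes A B k l ins outs D \<Longrightarrow> d \<notin> D \<Longrightarrow> completes A B k l ins (d # outs) D"
  by (simp add: completes_def)

context
  fixes A B :: "'a \<Rightarrow> bool" and D :: "'a set"
  assumes windows: "finite {v \<in> V. A v}" "finite {v \<in> V. B v}"
begin

lemma infeasible_sound:
  "\<lbrakk>infeasible N A B k l vs ins outs; completes A B k l ins outs D;
    set vs \<subseteq> V; \<forall>v\<in>set vs. covers N D v\<rbrakk> \<Longrightarrow> False"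
  "\<lbrakk>infeasible_choosing N A B k l vs ds ins outs; completes A B k l ins outs D;
    set vs \<subseteq> V; \<forall>v\<in>set vs. covers N D v;
    set ds \<subseteq> V; set ds \<inter> set ins = {}; set ds \<inter> D \<noteq> {}\<rbrakk> \<Longrightarrow> False"
  "\<lbrakk>infeasible_branch N A B k l vs d ds ins outs a b; completes A B k l ins outs D;
    set vs \<subseteq> V; \<forall>v\<in>set vs. covers N D v;
    set (d # ds) \<subseteq> V; set (d # ds) \<inter> set ins = {}; set (d # ds) \<inter> D \<noteq> {};
    a = cost N A ins d; b = cost N B ins d\<rbrakk> \<Longrightarrow> False"
proof (induction k l vs ins outs and k l vs ds ins outs and k l vs d ds ins outs a b
    rule: infeasible_infeasible_choosing_infeasible_branch.induct[where N = N and A = A and B = B])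
  case (2 k l v vs ins outs)
  show ?case
  proof (cases "covers N (set ins) v")
    case False
    then have "set (N v) \<inter> set ins = {}" by (auto simp: covers_def)
    moreover have "set (N v) \<subseteq> V" "set (N v) \<inter> D \<noteq> {}"
      using 2(5,6) nbrs_subset by (auto simp: covers_def)
    ultimately show ?thesis using 2 False by simp
  qed (use 2 in simp)
next
  case (4 k l vs d ds ins outs)
  then have "d \<in> set outs \<Longrightarrow> d \<notin> D" by (auto simp: completes_def)
  with 4 show ?case by (cases "d \<in> set outs") simp_all
next
  case (5 k l vs d ds ins outs a b)
  show ?case
  proof (cases "d \<in> D")
    case True
    then have step: "a \<le> k \<and> b \<le> l \<and> completes A B (k - a) (l - b) (d # ins) outs D"
      using completes_in[OF 5(5) _ _ _ windows] 5(8-12) by simp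
    then have "infeasible N A B (k - a) (l - b) vs (d # ins) outs"
      using 5(4) by (simp split: if_splits)
    with step show ?thesis using 5(1,6,7) by blast
  next
    case False
    have "infeasible_choosing N A B k l vs ds ins (d # outs)"
      using 5(4) by (simp split: if_splits)
    with False show ?thesis
      using 5 completes_out[OF 5(5) False] by (simp split: if_splits)
  qed
qed auto

end

end

section \<open>Periodic coverings of the infinite unrolled graph\<close>

datatype side = Left | Right

type_synonym vertex = "side \<times> int"

fun opposite :: "side \<Rightarrow> side" where
  "opposite Left = Right"
| "opposite Right = Left"

fun direction :: "side \<Rightarrow> int" where
  "direction Left = 1"
| "direction Right = - 1"

text \<open>As \<open>j mod 0 = j\<close>, the case \<open>m = 0\<close> is the infinite unrolled graph.\<close>

fun closed_nbrs :: "int list \<Rightarrow> int \<Rightarrow> vertex \<Rightarrow> vertex list" where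
  "closed_nbrs S m (a, j) =
    (a, j mod m) # map (\<lambda>s. (opposite a, (j + direction a * s) mod m)) S"

abbreviation reduced :: "int \<Rightarrow> vertex set" where
  "reduced m \<equiv> {v. snd v mod m = snd v}"

abbreviation covered :: "int list \<Rightarrow> vertex set \<Rightarrow> vertex \<Rightarrow> bool" where
  "covered S \<equiv> covers (closed_nbrs S 0)"

definition periodic :: "int \<Rightarrow> vertex set \<Rightarrow> bool" where
  "periodic m D \<longleftrightarrow> (\<forall>a j. (a, j mod m) \<in> D \<longleftrightarrow> (a, j) \<in> D)"

definition covering :: "int list \<Rightarrow> int \<Rightarrow> vertex set \<Rightarrow> vertex set \<Rightarrow> bool" where
  "covering S m Z D \<longleftrightarrow> periodic m D \<and> (\<forall>a j. (a, j mod m) \<notin> Z \<longrightarrow> covered S D (a, j))"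

definition hole :: "int list \<Rightarrow> int \<Rightarrow> vertex set \<Rightarrow> bool" where
  "hole S m D \<longleftrightarrow> covering S m {(Left, 0)} D \<and> \<not> covered S D (Left, 0)"

definition side_weight :: "int \<Rightarrow> vertex set \<Rightarrow> side \<Rightarrow> nat" where
  "side_weight m D a = (\<Sum>j\<in>{0..<m}. of_bool ((a, j) \<in> D))"

definition weight :: "int \<Rightarrow> vertex set \<Rightarrow> nat" where
  "weight m D = side_weight m D Left + side_weight m D Right"

definition side_excess :: "int list \<Rightarrow> int \<Rightarrow> vertex set \<Rightarrow> side \<Rightarrow> nat" where
  "side_excess S m D a = excess (closed_nbrs S 0) D ({a} \<times> {0..<m})"

lemma covering_empty_iff: "covering S m {} D \<longleftrightarrow> periodic m D \<and> (\<forall>v. covered S D v)"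
  by (simp add: covering_def)

lemma covering_periodic: "covering S m Z D \<Longrightarrow> periodic m D"
  by (simp add: covering_def)

lemma hole_periodic: "hole S m D \<Longrightarrow> periodic m D"
  by (simp add: hole_def covering_def)

lemma opposite_neq [simp]: "a \<noteq> opposite a"
  by (cases a) auto

lemma opposite_opposite [simp]: "opposite (opposite a) = a"
  by (cases a) auto

lemma direction_opposite [simp]: "direction (opposite a) = - direction a"
  by (cases a) auto

lemma closed_neighbourhoods_closed_nbrs:
  assumes "distinct (map (\<lambda>s. s mod m) S)"
  shows "closed_neighbourhoods (reduced m) (closed_nbrs S m)"
proof
  fix v assume "v \<in> reduced m"
  then obtain a j where v: "v = (a, j)" "j mod m = j" by (cases v) simp
  have shift_inj: "s mod m = t mod m"
    if "(j + direction a * s) mod m = (j + direction a * t) mod m" for s t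
    using that by (cases a) (auto simp: mod_eq_dvd_iff dvd_diff_commute[of m t s])
  have "inj_on (\<lambda>s. (opposite a, (j + direction a * s) mod m)) (set S)"
  proof (rule inj_onI)
    fix s t assume "s \<in> set S" "t \<in> set S"
      and "(opposite a, (j + direction a * s) mod m) = (opposite a, (j + direction a * t) mod m)"
    then show "s = t" using assms shift_inj[of s t] by (simp add: distinct_map inj_on_def)
  qed
  then show "distinct (closed_nbrs S m v)"
    using assms unfolding distinct_map by (auto simp: v distinct_map)
  show "set (closed_nbrs S m v) \<subseteq> reduced m" by (auto simp: v)
  fix d assume "d \<in> set (closed_nbrs S m v)"
  then consider "d = v" | s where "s \<in> set S" "d = (opposite a, (j + direction a * s) mod m)"
    unfolding v(1) closed_nbrs.simps v(2) by auto
  then show "v \<in> set (closed_nbrs S m d)"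
  proof cases
    case 2
    have "((j + direction a * s) mod m + - direction a * s) mod m
        = (j + direction a * s + - direction a * s) mod m"
      by (rule mod_add_left_eq)
    with 2 v show ?thesis by (auto intro: rev_image_eqI)
  qed (simp add: v)
qed

lemma coverage_closed_nbrs:
  "coverage (closed_nbrs S m) D (a, j) = of_bool ((a, j mod m) \<in> D)
    + (\<Sum>s\<leftarrow>S. of_bool ((opposite a, (j + direction a * s) mod m) \<in> D))"
proof -
  have "length (filter (\<lambda>d. d \<in> D) ds) = (\<Sum>d\<leftarrow>ds. of_bool (d \<in> D))" for ds
    by (induction ds) auto
  then show ?thesis by (simp add: coverage_def comp_def del: filter.simps)
qed

lemma coverage_eq_unrolled:
  assumes "periodic m D"
  shows "coverage (closed_nbrs S m) D v = coverage (closed_nbrs S 0) D v"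
  using assms by (cases v) (simp add: coverage_closed_nbrs periodic_def)

lemma coverage_mod:
  assumes "periodic m D"
  shows "coverage (closed_nbrs S 0) D (a, j mod m) = coverage (closed_nbrs S 0) D (a, j)"
  unfolding coverage_eq_unrolled[OF assms, symmetric]
  by (simp add: coverage_closed_nbrs mod_simps)

lemma covered_mod: "periodic m D \<Longrightarrow> covered S D (a, j mod m) \<longleftrightarrow> covered S D (a, j)"
  by (simp add: covers_iff_coverage coverage_mod)

lemma hole_if_not_covering:
  assumes "covering S m {(Left, 0)} D" "\<not> covering S m {} D"
  shows "hole S m D"
proof -
  have D: "periodic m D" "\<And>a j. (a, j mod m) \<noteq> (Left, 0) \<Longrightarrow> covered S D (a, j)"
    using assms(1) by (auto simp: covering_def)
  then obtain a j where aj: "\<not> covered S D (a, j)" using assms(2) by (auto simp: covering_def)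
  with D(2) have "a = Left" "j mod m = 0" by blast+
  with aj have "\<not> covered S D (Left, 0)" using covered_mod[OF D(1), of S a j] by simp
  with assms(1) show ?thesis by (simp add: hole_def)
qed

lemma sum_periodic_affine:
  fixes f :: "int \<Rightarrow> 'a :: comm_monoid_add"
  assumes "0 < m" "\<And>j. f (j mod m) = f j" "c \<in> {1, - 1}"
  shows "(\<Sum>j\<in>{0..<m}. f (i + c * j)) = (\<Sum>j\<in>{0..<m}. f j)"
proof -
  have "bij_betw (\<lambda>j. (i + c * j) mod m) {0..<m} {0..<m}"
    by (rule bij_betw_byWitness[where f' = "\<lambda>j. (c * (j - i)) mod m"])
      (use assms(1,3) in \<open>auto simp: mod_simps\<close>)
  then have "(\<Sum>j\<in>{0..<m}. f ((i + c * j) mod m)) = (\<Sum>j\<in>{0..<m}. f j)"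
    by (rule sum.reindex_bij_betw)
  then show ?thesis by (simp add: assms(2))
qed

lemma direction_unit: "direction a \<in> {1, - 1}"
  by (cases a) auto

lemma side_weight_affine:
  assumes "0 < m" "periodic m D" "c \<in> {1, - 1}"
  shows "(\<Sum>j\<in>{0..<m}. of_bool ((a, i + c * j) \<in> D)) = side_weight m D a"
  unfolding side_weight_def
  using assms by (intro sum_periodic_affine) (simp_all add: periodic_def)

lemma sum_coverage:
  assumes "0 < m" "periodic m D"
  shows "(\<Sum>j\<in>{0..<m}. coverage (closed_nbrs S 0) D (a, j))
    = side_weight m D a + length S * side_weight m D (opposite a)"
proof (induction S)
  case Nil
  show ?case by (simp add: coverage_closed_nbrs side_weight_def del: sum_of_bool_eq)
next
  case (Cons s S)
  have "coverage (closed_nbrs (s # S) 0) D (a, j)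
      = of_bool ((opposite a, direction a * s + 1 * j) \<in> D) + coverage (closed_nbrs S 0) D (a, j)"
    for j
    by (simp add: coverage_closed_nbrs add.commute)
  then show ?case
    using Cons side_weight_affine[OF assms, of 1]
    by (simp only: sum.distrib) simp
qed

lemma side_excess_add_card_covered:
  assumes "0 < m" "periodic m D"
  shows "side_excess S m D a + card {j \<in> {0..<m}. covered S D (a, j)}
    = side_weight m D a + length S * side_weight m D (opposite a)"
proof -
  let ?W = "{a} \<times> {0..<m}"
  have "card {v \<in> ?W. covered S D v} = card (Pair a ` {j \<in> {0..<m}. covered S D (a, j)})"
    by (rule arg_cong[of _ _ card]) auto
  also have "\<dots> = card {j \<in> {0..<m}. covered S D (a, j)}"
    by (intro card_image inj_onI) simp
  finally have "side_excess S m D a + card {j \<in> {0..<m}. covered S D (a, j)}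
      = (\<Sum>v\<in>?W. coverage (closed_nbrs S 0) D v)"
    using excess_add_card_covered[of ?W "closed_nbrs S 0" D]
    by (simp only: side_excess_def finite_cartesian_product finite.intros
      finite_atLeastLessThan_int)
  also have "\<dots> = (\<Sum>j\<in>{0..<m}. coverage (closed_nbrs S 0) D (a, j))"
    by (simp add: sum.cartesian_product')
  finally show ?thesis using sum_coverage[OF assms] by simp
qed

lemma side_excess_covering:
  assumes "0 < m" "covering S m {} D"
  shows "int (side_excess S m D a) + m
    = int (side_weight m D a + length S * side_weight m D (opposite a))"
proof -
  have "{j \<in> {0..<m}. covered S D (a, j)} = {0..<m}" using assms(2) by (auto simp: covering_def)
  then have "int (card {j \<in> {0..<m}. covered S D (a, j)}) = m" using assms(1) by simp
  with side_excess_add_card_covered[OF assms(1) covering_periodic[OF assms(2)], of S a]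
  show ?thesis by linarith
qed

lemma side_excess_hole:
  assumes "0 < m" "hole S m D"
  shows "int (side_excess S m D a) + m
    = int (side_weight m D a + length S * side_weight m D (opposite a)) + of_bool (a = Left)"
proof -
  have D: "periodic m D" "\<not> covered S D (Left, 0)"
    "\<And>j. (a, j mod m) \<noteq> (Left, 0) \<Longrightarrow> covered S D (a, j)"
    using assms(2) by (auto simp: hole_def covering_def)
  have "{j \<in> {0..<m}. covered S D (a, j)} = {of_bool (a = Left)..<m}"
  proof (cases a)
    case Left
    with D(2,3) show ?thesis by (auto simp: order.order_iff_strict)
  next
    case Right
    with D(3) show ?thesis by auto
  qed
  then have "int (card {j \<in> {0..<m}. covered S D (a, j)}) = m - of_bool (a = Left)"
    using assms(1) by simp
  with side_excess_add_card_covered[OF assms(1) D(1), of S a] show ?thesis by linarith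
qed

text \<open>The automorphism of the unrolled graph that moves \<open>(Left, 0)\<close> to the given vertex.\<close>

fun transport :: "vertex \<Rightarrow> vertex \<Rightarrow> vertex" where
  "transport (a, i) (b, j) = (if a = Left then b else opposite b, i + direction a * j)"

lemma closed_nbrs_transport:
  "closed_nbrs S 0 (transport u v) = map (transport u) (closed_nbrs S 0 v)"
proof -
  obtain a i b j where "u = (a, i)" "v = (b, j)" by (metis surj_pair)
  then show ?thesis by (cases a; cases b) (auto simp: algebra_simps)
qed

lemma covered_transport: "covered S (transport u -` D) v \<longleftrightarrow> covered S D (transport u v)"
  by (auto simp: covers_def closed_nbrs_transport simp del: closed_nbrs.simps)

lemma periodic_transport:
  assumes "periodic m D"
  shows "periodic m (transport u -` D)"
proof -
  have "(i + direction a * (j mod m)) mod m = (i + direction a * j) mod m" for a i j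
    by (cases a) (simp_all add: mod_simps)
  then show ?thesis using assms unfolding periodic_def
    by (cases u) (metis transport.simps vimage_eq)
qed

lemma side_weight_transport:
  assumes "0 < m" "periodic m D"
  shows "side_weight m (transport (a, i) -` D) b
    = side_weight m D (if a = Left then b else opposite b)"
  using side_weight_affine[OF assms direction_unit]
  by (simp add: side_weight_def[of m "transport (a, i) -` D"] del: sum_of_bool_eq)

lemma weight_transport:
  assumes "0 < m" "periodic m D"
  shows "weight m (transport u -` D) = weight m D"
proof -
  obtain a i where "u = (a, i)" by (cases u)
  then show ?thesis by (cases a) (simp_all add: weight_def side_weight_transport[OF assms])
qed

lemma covering_transport:
  "covering S m {} D \<Longrightarrow> covering S m {} (transport u -` D)"
  unfolding covering_empty_iff using periodic_transport covered_transport by blast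

section \<open>Searching around an anchor\<close>

definition within :: "int \<Rightarrow> side \<Rightarrow> int \<Rightarrow> vertex \<Rightarrow> bool" where
  "within r a x v \<longleftrightarrow> fst v = a \<and> \<bar>snd v - x\<bar> \<le> r"

text \<open>The order of the list decides the size of the search tree.\<close>

definition ball :: "int \<Rightarrow> int \<Rightarrow> int \<Rightarrow> int \<Rightarrow> vertex list" where
  "ball m x y r = concat (map (\<lambda>i. [(Left, (x - i) mod m), (Right, (y - i) mod m),
    (Left, (x + i) mod m), (Right, (y + i) mod m)]) [0..r])"

definition no_hole :: "int list \<Rightarrow> int \<Rightarrow> int \<Rightarrow> int \<Rightarrow> int \<Rightarrow> nat \<Rightarrow> nat \<Rightarrow> bool" where
  "no_hole S m x y r k l \<longleftrightarrow>
    infeasible (closed_nbrs S m) (within r Left x) (within r Right y) k l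
      (filter (\<lambda>v. v \<noteq> (Left, 0)) (ball m x y r)) [] (closed_nbrs S m (Left, 0))"

definition no_close_pair :: "int list \<Rightarrow> int \<Rightarrow> int \<Rightarrow> int \<Rightarrow> int \<Rightarrow> nat \<Rightarrow> nat \<Rightarrow> bool" where
  "no_close_pair S m x y r k l \<longleftrightarrow>
    infeasible_choosing (closed_nbrs S m) (within r Left x) (within r Right y) k l
      (ball m x y r) (map (Pair Right) [1..int (length S)]) [(Right, 0)] []"

text \<open>The search for sets of period \<open>m\<close> runs in the cyclic graph itself (\<open>m' = m\<close>), or in the
  unrolled graph (\<open>m' = 0\<close>) with windows no longer than the period.\<close>

definition fits :: "int list \<Rightarrow> int \<Rightarrow> int \<Rightarrow> int \<Rightarrow> bool" where
  "fits S m m' r \<longleftrightarrow> 0 < m \<and> distinct (map (\<lambda>s. s mod m') S) \<and>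
    (m' = m \<and> int (length S) < m \<or> m' = 0 \<and> 2 * r < m)"

lemma ball_reduced: "set (ball m x y r) \<subseteq> reduced m"
  by (auto simp: ball_def)

lemma finite_within: "finite {v \<in> V. within r a x v}"
proof (rule finite_subset)
  show "{v \<in> V. within r a x v} \<subseteq> {a} \<times> {x - r..x + r}" by (auto simp: within_def)
qed simp

context
  fixes S :: "int list" and m m' r :: int and D :: "vertex set"
  assumes fits: "fits S m m' r" and periodic: "periodic m D"
begin

interpretation closed_neighbourhoods "reduced m'" "closed_nbrs S m'"
  using fits by (simp add: fits_def closed_neighbourhoods_closed_nbrs)

lemma coverage_searched:
  "coverage (closed_nbrs S m') D v = coverage (closed_nbrs S 0) D v"
  using fits coverage_eq_unrolled[OF periodic] unfolding fits_def by blast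

lemma covers_iff_covered: "covers (closed_nbrs S m') D v \<longleftrightarrow> covered S D v"
  by (simp add: covers_iff_coverage coverage_searched)

lemma excess_window_le:
  "excess (closed_nbrs S m') D {v \<in> reduced m'. within r a x v} \<le> side_excess S m D a"
proof -
  define J where "J = {j. j mod m' = j \<and> \<bar>j - x\<bar> \<le> r}"
  let ?e = "\<lambda>j. coverage (closed_nbrs S 0) D (a, j) - 1"
  have m: "0 < m" using fits by (simp add: fits_def)
  have "inj_on (\<lambda>j. j mod m) J"
  proof (rule inj_onI)
    fix i j assume ij: "i \<in> J" "j \<in> J" "i mod m = j mod m"
    show "i = j"
    proof (cases "m' = m")
      case False
      with ij fits have "m dvd i - j" "\<bar>i - j\<bar> < m" by (auto simp: J_def fits_def mod_eq_dvd_iff)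
      then show ?thesis using zdvd_imp_le[of m "\<bar>i - j\<bar>"] by force
    qed (use ij in \<open>simp add: J_def\<close>)
  qed
  moreover have "{v \<in> reduced m'. within r a x v} = Pair a ` J"
    by (auto simp: J_def within_def)
  ultimately have "excess (closed_nbrs S m') D {v \<in> reduced m'. within r a x v}
      = (\<Sum>j\<in>(\<lambda>j. j mod m) ` J. ?e j)"
    by (simp add: excess_def sum.reindex inj_on_def[of "Pair a"] coverage_searched
      coverage_mod[OF periodic])
  also have "\<dots> \<le> (\<Sum>j\<in>{0..<m}. ?e j)"
    using m by (intro sum_mono2) auto
  also have "\<dots> = side_excess S m D a"
    by (simp add: side_excess_def excess_def sum.cartesian_product')
  finally show ?thesis .
qed

lemma completes_within:
  assumes "set ins \<subseteq> D" "set outs \<inter> D = {}"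
    and "side_excess S m D Left \<le> k" "side_excess S m D Right \<le> l"
  shows "completes (within r Left x) (within r Right y) k l ins outs D"
  unfolding completes_def
  using assms excess_window_le[of Left x] excess_window_le[of Right y] by linarith

lemma no_hole_excess:
  assumes "no_hole S m' x y r k l" "hole S m D" "m' = m \<or> \<bar>x\<bar> + r < m"
  shows "k < side_excess S m D Left \<or> l < side_excess S m D Right"
proof (rule ccontr)
  let ?vs = "filter (\<lambda>v. v \<noteq> (Left, 0)) (ball m' x y r)"
  assume "\<not> ?thesis"
  moreover have "set (closed_nbrs S m' (Left, 0)) \<inter> D = {}"
    using assms(2) covers_iff_covered[of "(Left, 0)"] unfolding hole_def covers_def by blast
  ultimately have
    "completes (within r Left x) (within r Right y) k l [] (closed_nbrs S m' (Left, 0)) D"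
    by (intro completes_within) auto
  moreover have "covers (closed_nbrs S m') D v" if v: "v \<in> set ?vs" for v
  proof -
    obtain a j where aj: "v = (a, j)" by (cases v)
    have "(a, j mod m) \<noteq> (Left, 0)"
    proof (cases "m' = m")
      case True
      with v ball_reduced[of m' x y r] show ?thesis by (auto simp: aj)
    next
      case False
      with fits assms(3) have "m' = 0" "\<bar>x\<bar> + r < m" by (auto simp: fits_def)
      with v have "a = Left \<longrightarrow> j \<noteq> 0 \<and> \<bar>j\<bar> < m" by (auto simp: aj ball_def)
      then show ?thesis using zdvd_imp_le[of m "\<bar>j\<bar>"] by (auto simp: mod_eq_0_iff_dvd)
    qed
    with assms(2) show ?thesis by (simp add: covers_iff_covered aj hole_def covering_def)
  qed
  ultimately show False
    using infeasible_sound(1)[OF finite_within finite_within] assms(1) ball_reduced[of m' x y r]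
    unfolding no_hole_def by (meson filter_is_subset order_trans)
qed

lemma no_close_pair_excess_anchored:
  assumes "no_close_pair S m' x y r k l" "covering S m {} D"
    and "(Right, 0) \<in> D" "(Right, s) \<in> D" "s \<in> {1..int (length S)}"
  shows "k < side_excess S m D Left \<or> l < side_excess S m D Right"
proof (rule ccontr)
  let ?ds = "map (Pair Right) [1..int (length S)]"
  assume "\<not> ?thesis"
  then have completes: "completes (within r Left x) (within r Right y) k l [(Right, 0)] [] D"
    using assms(3) by (intro completes_within) auto
  have covered: "\<forall>v\<in>set (ball m' x y r). covers (closed_nbrs S m') D v"
    using assms(2) unfolding covers_iff_covered covering_empty_iff by blast
  have "(Right, s) \<in> set ?ds \<inter> D" using assms(4,5) by auto
  then have chosen: "set ?ds \<inter> D \<noteq> {}" by blast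
  have "set ?ds \<subseteq> reduced m'" "set ?ds \<inter> set [(Right, 0)] = {}"
    using fits by (auto simp: fits_def)
  from infeasible_sound(2)[OF finite_within finite_within assms(1)[unfolded no_close_pair_def]
      completes ball_reduced covered this chosen]
  show False .
qed

end

lemma close_pair_exists:
  assumes "0 < m" "periodic m D" "m < int d * int (side_weight m D a)"
  obtains p s where "(a, p) \<in> D" "(a, p + s) \<in> D" "s \<in> {1..<int d}"
proof (rule ccontr)
  note found = that
  assume no_pair: "\<not> thesis"
  have at_most_one: "card {s \<in> {0..<int d}. (a, j + s) \<in> D} \<le> 1" for j
  proof -
    let ?A = "{s \<in> {0..<int d}. (a, j + s) \<in> D}"
    have "\<not> s < t" if "s \<in> ?A" "t \<in> ?A" for s t
      using that no_pair found[of "j + s" "t - s"] by auto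
    then have "\<forall>s\<in>?A. \<forall>t\<in>?A. s = t" by (meson linorder_neqE)
    moreover have "finite ?A" by (rule finite_subset[of _ "{0..<int d}"]) auto
    ultimately show ?thesis by (simp only: One_nat_def card_le_Suc0_iff_eq)
  qed
  have "int d * int (side_weight m D a)
      = int (\<Sum>s\<in>{0..<int d}. \<Sum>j\<in>{0..<m}. of_bool ((a, s + 1 * j) \<in> D))"
    using side_weight_affine[OF assms(1,2), of 1 a] by simp
  also have "\<dots> = int (\<Sum>j\<in>{0..<m}. card {s \<in> {0..<int d}. (a, j + s) \<in> D})"
    by (subst sum.swap) (simp add: Int_def add.commute)
  also have "\<dots> \<le> int (\<Sum>j\<in>{0..<m}. 1)"
    using at_most_one by (simp only: of_nat_le_iff sum_mono)
  finally show False using assms(1,3) by simp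
qed

lemma side_excess_transport:
  assumes "0 < m" "covering S m {} D"
  shows "side_excess S m (transport (a, i) -` D) b
    = side_excess S m D (if a = Left then b else opposite b)"
  using side_excess_covering[OF assms(1) covering_transport[OF assms(2)], of "(a, i)" b]
    side_excess_covering[OF assms, of "if a = Left then b else opposite b"]
  by (auto simp: side_weight_transport[OF assms(1) covering_periodic[OF assms(2)]] split: if_splits)

lemma no_close_pair_excess:
  assumes "no_close_pair S m' x y r k l" "fits S m m' r" "covering S m {} D"
    and "m < int (Suc (length S)) * int (side_weight m D a)"
  shows "k < side_excess S m D (opposite a) \<or> l < side_excess S m D a"
proof -
  have m: "0 < m" using assms(2) by (simp add: fits_def)
  note D = covering_periodic[OF assms(3)]
  obtain p s where p: "(a, p) \<in> D" "(a, p + s) \<in> D" "s \<in> {1..<int (Suc (length S))}"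
    using close_pair_exists[OF m D assms(4)] .
  define u where "u = (if a = Right then (Left, p) else (Right, p + s))"
  let ?D = "transport u -` D"
  have "(Right, 0) \<in> ?D" "(Right, s) \<in> ?D" using p by (cases a; simp add: u_def)+
  with no_close_pair_excess_anchored[OF assms(2) periodic_transport[OF D] assms(1)
      covering_transport[OF assms(3)]] p(3)
  have "k < side_excess S m ?D Left \<or> l < side_excess S m ?D Right" by simp
  then show ?thesis
    using side_excess_transport[OF m assms(3)] by (cases a) (simp_all add: u_def)
qed

section \<open>Dominating sets of Knodel graphs\<close>

lemma domination_number_le_iff:
  "domination_number V E \<le> k \<longleftrightarrow> (\<exists>D. dominating V E D \<and> card D \<le> k)"
proof
  have "\<exists>k D. dominating V E D \<and> card D = k"
    by (auto simp: dominating_def intro!: exI[of _ V])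
  then have "\<exists>D. dominating V E D \<and> card D = domination_number V E"
    unfolding domination_number_def by (rule LeastI_ex)
  then show "domination_number V E \<le> k \<Longrightarrow> \<exists>D. dominating V E D \<and> card D \<le> k" by metis
next
  assume "\<exists>D. dominating V E D \<and> card D \<le> k"
  then obtain D where D: "dominating V E D" "card D \<le> k" by blast
  then have "domination_number V E \<le> card D"
    unfolding domination_number_def by (intro Least_le) blast
  with D(2) show "domination_number V E \<le> k" by simp
qed

lemma weight_eq_card: "weight m P = card (P \<inter> UNIV \<times> {0..<m})"
proof -
  let ?A = "\<lambda>a. Pair a ` {j \<in> {0..<m}. (a, j) \<in> P}"
  have "v \<in> ?A Left \<union> ?A Right" if "v \<in> P \<inter> UNIV \<times> {0..<m}" for v
    using that by (cases v; cases "fst v") auto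
  then have "P \<inter> UNIV \<times> {0..<m} = ?A Left \<union> ?A Right" by auto
  moreover have "card (?A a) = side_weight m P a" for a
    by (subst card_image) (simp_all add: inj_on_def side_weight_def Int_def)
  moreover have "finite (?A a)" for a
    by (rule finite_imageI, rule finite_subset[of _ "{0..<m}"]) auto
  moreover have "?A Left \<inter> ?A Right = {}" by auto
  ultimately show ?thesis by (simp only: weight_def card_Un_disjoint)
qed

definition offsets :: "nat \<Rightarrow> int list" where
  "offsets \<Delta> = map (\<lambda>k. 2 ^ k - 1) [0..<\<Delta>]"

context
  fixes n \<Delta> :: nat
  assumes nonempty: "2 \<le> n"
begin

abbreviation period :: int where
  "period \<equiv> int (n div 2)"

definition proj :: "vertex \<Rightarrow> nat \<times> nat" where
  "proj v = (if fst v = Left then 1 else 2, nat (snd v mod period))"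

lemma period_pos: "0 < period"
  using nonempty by simp

lemma proj_eq_iff: "proj (a, i) = proj (b, j) \<longleftrightarrow> a = b \<and> i mod period = j mod period"
  using period_pos by (cases a; cases b) (auto simp: proj_def eq_nat_nat_iff)

lemma range_proj: "range proj = knodel_vertices n"
proof
  show "range proj \<subseteq> knodel_vertices n"
    using period_pos by (auto simp: proj_def knodel_vertices_def nat_less_iff)
  have "(1, j) = proj (Left, int j)" "(2, j) = proj (Right, int j)" if "j < n div 2" for j
    using that by (simp_all add: proj_def)
  then show "knodel_vertices n \<subseteq> range proj"
    by (auto simp: knodel_vertices_def intro: range_eqI)
qed

lemma knodel_adj_iff:
  "knodel_adj \<Delta> n u v \<longleftrightarrow> (\<exists>i. \<exists>s\<in>set (offsets \<Delta>).
    u = proj (Left, i) \<and> v = proj (Right, i + s) \<or> v = proj (Left, i) \<and> u = proj (Right, i + s))"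
    (is "_ \<longleftrightarrow> (\<exists>i. \<exists>s\<in>_. ?edge i s)")
proof -
  have left: "proj (Left, int j) = (1, j)" if "j < n div 2" for j
    using that by (simp add: proj_def)
  have right: "proj (Right, int j + (2 ^ k - 1)) = (2, (j + 2 ^ k - 1) mod (n div 2))" for j k
  proof -
    have "int j + (2 ^ k - 1) = int (j + 2 ^ k - 1)"
      using one_le_power[of "2::nat" k] by (simp add: of_nat_diff trans_le_add2 del: one_le_power)
    then show ?thesis by (simp only: proj_def fst_conv snd_conv flip: zmod_int) simp
  qed
  have "(\<exists>s\<in>set (offsets \<Delta>). Q s) \<longleftrightarrow> (\<exists>k<\<Delta>. Q (2 ^ k - 1))" for Q
    by (auto simp: offsets_def)
  then have "(\<exists>i. \<exists>s\<in>set (offsets \<Delta>). ?edge i s) \<longleftrightarrow> (\<exists>i k. k < \<Delta> \<and> ?edge i (2 ^ k - 1))"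
    by (simp only:)
  also have "\<dots> \<longleftrightarrow> (\<exists>j k. k < \<Delta> \<and> j < n div 2 \<and> ?edge (int j) (2 ^ k - 1))"
  proof
    assume "\<exists>i k. k < \<Delta> \<and> ?edge i (2 ^ k - 1)"
    then obtain i k where ik: "k < \<Delta>" "?edge i (2 ^ k - 1)" by blast
    define j where "j = nat (i mod period)"
    have j: "j < n div 2" "int j = i mod period"
      using period_pos by (simp_all add: j_def nat_less_iff)
    then have "proj (Left, int j) = proj (Left, i)"
      "proj (Right, int j + (2 ^ k - 1)) = proj (Right, i + (2 ^ k - 1))"
      unfolding proj_eq_iff j(2) by (simp_all add: mod_add_left_eq)
    with ik j(1) show "\<exists>j k. k < \<Delta> \<and> j < n div 2 \<and> ?edge (int j) (2 ^ k - 1)" by metis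
  qed blast
  also have "\<dots> \<longleftrightarrow> knodel_adj \<Delta> n u v"
    unfolding knodel_adj_def right using left by metis
  finally show ?thesis by blast
qed

lemma knodel_adj_proj_iff:
  "knodel_adj \<Delta> n u (proj (a, j)) \<longleftrightarrow>
    (\<exists>s\<in>set (offsets \<Delta>). u = proj (opposite a, j + direction a * s))"
proof (cases a)
  case Left
  have "proj (Left, j) = proj (Left, i) \<Longrightarrow> proj (Right, i + s) = proj (Right, j + s)" for i s
    unfolding proj_eq_iff by (auto intro: mod_add_cong)
  moreover have "proj (Left, j) \<noteq> proj (Right, i)" for i
    by (simp add: proj_eq_iff)
  ultimately show ?thesis
    unfolding knodel_adj_iff Left opposite.simps direction.simps mult_1 by metis
next
  case Right
  have "proj (Right, j) = proj (Right, i + s) \<Longrightarrow> proj (Left, i) = proj (Left, j - s)" for i s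
    unfolding proj_eq_iff using mod_diff_cong[of j period "i + s" s s] by simp
  moreover have "proj (Right, j) \<noteq> proj (Left, i)" for i
    by (simp add: proj_eq_iff)
  ultimately show ?thesis
    unfolding knodel_adj_iff Right opposite.simps direction.simps mult_minus1 add_uminus_conv_diff
    by (metis diff_add_cancel)
qed

lemma dominated_iff_covered:
  "proj v \<in> D \<or> (\<exists>d\<in>D. knodel_adj \<Delta> n d (proj v)) \<longleftrightarrow> covered (offsets \<Delta>) (proj -` D) v"
  by (cases v) (auto simp: covers_def knodel_adj_proj_iff)

lemma dominating_diff_iff:
  "dominating (knodel_vertices n - U) (knodel_adj \<Delta> n) D \<longleftrightarrow>
    D \<subseteq> knodel_vertices n - U \<and> (\<forall>v. proj v \<notin> U \<longrightarrow> covered (offsets \<Delta>) (proj -` D) v)"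
proof -
  have "dominating (knodel_vertices n - U) (knodel_adj \<Delta> n) D \<longleftrightarrow> D \<subseteq> knodel_vertices n - U
      \<and> (\<forall>v\<in>range proj. v \<notin> U \<longrightarrow> v \<in> D \<or> (\<exists>d\<in>D. knodel_adj \<Delta> n d v))"
    by (auto simp: dominating_def range_proj)
  then show ?thesis by (simp add: dominated_iff_covered)
qed

lemma periodic_vimage_proj: "periodic period (proj -` D)"
  by (simp add: periodic_def proj_def)

lemma vimage_image_proj:
  assumes "periodic period P"
  shows "proj -` proj ` P = P"
proof -
  have "(a, i) \<in> P" if "proj (a, i) = proj (b, j)" "(b, j) \<in> P" for a b i j
    using that assms unfolding proj_eq_iff periodic_def by metis
  then show ?thesis by auto
qed

lemma card_eq_weight:
  assumes "D \<subseteq> knodel_vertices n"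
  shows "card D = weight period (proj -` D)"
proof -
  let ?P = "proj -` D \<inter> UNIV \<times> {0..<period}"
  have "u = v" if "proj u = proj v" "u \<in> ?P" "v \<in> ?P" for u v
  proof (cases u; cases v)
    fix a i b j assume uv: "u = (a, i)" "v = (b, j)"
    with that(1) have "a = b \<and> i mod period = j mod period" by (simp only: proj_eq_iff)
    with uv that(2,3) show ?thesis by simp
  qed
  then have "inj_on proj ?P" by (rule inj_onI)
  then have "card (proj ` ?P) = weight period (proj -` D)"
    unfolding weight_eq_card by (rule card_image)
  moreover have "v \<in> proj ` ?P" if "v \<in> D" for v
  proof -
    have "v \<in> range proj" using that assms range_proj by blast
    then obtain a j where "v = proj (a, j)" by auto
    then have "v = proj (a, j mod period)" by (simp add: proj_eq_iff)
    moreover have "j mod period \<in> {0..<period}" using period_pos by simp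
    ultimately show ?thesis using that by blast
  qed
  then have "proj ` ?P = D" by blast
  ultimately show ?thesis by (simp only:)
qed

lemma domination_number_diff_knodel_le_iff:
  "domination_number (knodel_vertices n - U) (knodel_adj \<Delta> n) \<le> k \<longleftrightarrow>
    (\<exists>P. periodic period P \<and> proj ` P \<inter> U = {} \<and>
      (\<forall>v. proj v \<notin> U \<longrightarrow> covered (offsets \<Delta>) P v) \<and> weight period P \<le> k)"
    (is "_ \<longleftrightarrow> (\<exists>P. ?avoids P)")
  unfolding domination_number_le_iff dominating_diff_iff
proof (intro iffI; elim exE conjE)
  fix D assume D: "D \<subseteq> knodel_vertices n - U" "card D \<le> k"
    "\<forall>v. proj v \<notin> U \<longrightarrow> covered (offsets \<Delta>) (proj -` D) v"
  then have "D \<subseteq> knodel_vertices n" "proj ` proj -` D \<inter> U = {}" by blast+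
  with D(2,3) show "\<exists>P. ?avoids P"
    using card_eq_weight periodic_vimage_proj by (intro exI[of _ "proj -` D"]) simp
next
  fix P assume P: "periodic period P" "proj ` P \<inter> U = {}" "weight period P \<le> k"
    "\<forall>v. proj v \<notin> U \<longrightarrow> covered (offsets \<Delta>) P v"
  have D: "proj ` P \<subseteq> knodel_vertices n - U" using P(2) range_proj by blast
  then have "card (proj ` P) = weight period P"
    using card_eq_weight[of "proj ` P"] vimage_image_proj[OF P(1)] by auto
  with D P(3,4) show "\<exists>D. (D \<subseteq> knodel_vertices n - U \<and>
      (\<forall>v. proj v \<notin> U \<longrightarrow> covered (offsets \<Delta>) (proj -` D) v)) \<and> card D \<le> k"
    using vimage_image_proj[OF P(1)] by (intro exI[of _ "proj ` P"]) simp
qed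

lemma domination_number_knodel_le_iff:
  "domination_number (knodel_vertices n) (knodel_adj \<Delta> n) \<le> k \<longleftrightarrow>
    (\<exists>P. covering (offsets \<Delta>) period {} P \<and> weight period P \<le> k)"
  using domination_number_diff_knodel_le_iff[of "{}"]
  unfolding covering_empty_iff by simp

lemma proj_transport_eq_iff: "proj (transport w u) = proj (transport w v) \<longleftrightarrow> proj u = proj v"
proof -
  obtain a i b j c l where "w = (a, i)" "u = (b, j)" "v = (c, l)" by (metis surj_pair)
  then show ?thesis
    by (cases a; cases b; cases c)
      (auto simp: proj_eq_iff mod_eq_dvd_iff dvd_diff_commute[of period l j])
qed

lemma hole_covered_iff:
  assumes "hole S period P"
  shows "covered S P v \<longleftrightarrow> proj v \<noteq> proj (Left, 0)"
proof (cases v)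
  case (Pair a j)
  have P: "periodic period P" "\<not> covered S P (Left, 0)"
    "\<And>b i. (b, i mod period) \<noteq> (Left, 0) \<Longrightarrow> covered S P (b, i)"
    using assms by (auto simp: hole_def covering_def)
  then show ?thesis
    using P(3)[of a j] covered_mod[OF P(1), of S a j] by (auto simp: Pair proj_eq_iff)
qed

lemma domination_number_diff_vertex_knodel_le:
  assumes "hole (offsets \<Delta>) period P" "u \<in> knodel_vertices n"
  shows "domination_number (knodel_vertices n - {u}) (knodel_adj \<Delta> n) \<le> weight period P"
proof -
  obtain a i where u: "u = proj (a, i)" using assms(2) range_proj by (metis imageE surj_pair)
  have P: "periodic period P" using assms(1) by (simp add: hole_def covering_def)
  let ?w = "(a, - direction a * i)"
  have "transport ?w (a, i) = (Left, 0)" by (cases a) auto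
  then have moved: "proj (transport ?w v) = proj (Left, 0) \<longleftrightarrow> proj v = u" for v
    unfolding u using proj_transport_eq_iff by metis
  have "v \<in> P \<Longrightarrow> covered (offsets \<Delta>) P v" for v
    by (cases v) (auto simp: covers_def)
  then have "proj ` (transport ?w -` P) \<inter> {u} = {}"
    using moved hole_covered_iff[OF assms(1)] by blast
  moreover have "\<forall>v. proj v \<notin> {u} \<longrightarrow> covered (offsets \<Delta>) (transport ?w -` P) v"
    unfolding covered_transport using moved hole_covered_iff[OF assms(1)] by blast
  ultimately show ?thesis
    unfolding domination_number_diff_knodel_le_iff
    using periodic_transport[OF P] weight_transport[OF period_pos P]
    by (intro exI[of _ "transport ?w -` P"]) simp
qed

lemma gamma_critical_knodel_iff:
  "gamma_critical (knodel_vertices n) (knodel_adj \<Delta> n) \<longleftrightarrow>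
    (\<exists>P. hole (offsets \<Delta>) period P \<and>
      weight period P < domination_number (knodel_vertices n) (knodel_adj \<Delta> n))"
    (is "gamma_critical ?V ?E \<longleftrightarrow> (\<exists>P. ?small P)")
proof
  let ?o = "proj (Left, 0)"
  assume "gamma_critical ?V ?E"
  then have less: "domination_number (?V - {?o}) ?E < domination_number ?V ?E"
    using range_proj by (auto simp: gamma_critical_def)
  obtain P where P: "periodic period P" "\<forall>v. proj v \<notin> {?o} \<longrightarrow> covered (offsets \<Delta>) P v"
      "weight period P \<le> domination_number (?V - {?o}) ?E"
    using iffD1[OF domination_number_diff_knodel_le_iff order_refl] by blast
  then have "covering (offsets \<Delta>) period {(Left, 0)} P"
    by (auto simp: covering_def proj_eq_iff)
  moreover have "weight period P < domination_number ?V ?E" using P(3) less by simp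
  moreover from this have "\<not> covering (offsets \<Delta>) period {} P"
    using iffD2[OF domination_number_knodel_le_iff, of "weight period P"] by fastforce
  ultimately show "\<exists>P. ?small P" using hole_if_not_covering by blast
next
  assume "\<exists>P. ?small P"
  then show "gamma_critical ?V ?E"
    unfolding gamma_critical_def using domination_number_diff_vertex_knodel_le
    by (meson order_le_less_trans)
qed

end

section \<open>Coverings from words\<close>

text \<open>The letter at position \<open>j\<close> lists the sides of the chosen vertices with index \<open>j\<close>.\<close>

definition word_set :: "side list list \<Rightarrow> vertex set" where
  "word_set w = {(a, j). a \<in> set (w ! nat (j mod int (length w)))}"

text \<open>Lists in place of sets and intervals let this predicate be evaluated by rewriting.\<close>

definition covering_word :: "int list \<Rightarrow> vertex list \<Rightarrow> side list list \<Rightarrow> bool" where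
  "covering_word S Z w \<longleftrightarrow> w \<noteq> [] \<and>
    (\<forall>a\<in>set [Left, Right]. \<forall>j\<in>set [0..int (length w) - 1]. (a, j) \<notin> set Z \<longrightarrow>
      (\<exists>(b, i)\<in>set (closed_nbrs S (int (length w)) (a, j)). b \<in> set (w ! nat i)))"

definition pumped :: "'a list \<Rightarrow> 'a list \<Rightarrow> 'a list \<Rightarrow> nat \<Rightarrow> 'a list" where
  "pumped u p t k = u @ concat (replicate k p) @ t"

lemma periodic_word_set: "periodic (int (length w)) (word_set w)"
  by (simp add: periodic_def word_set_def)

lemma weight_word_set_le: "weight (int (length w)) (word_set w) \<le> length (concat w)"
proof -
  have "of_bool (Left \<in> A) + of_bool (Right \<in> A) = card (A \<inter> {Left, Right})" for A
    by (simp add: Int_insert_right)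
  then have "weight (int (length w)) (word_set w)
      = (\<Sum>j\<in>{0..<int (length w)}. card (set (w ! nat j) \<inter> {Left, Right}))"
    by (simp add: weight_def side_weight_def word_set_def del: sum_of_bool_eq
      flip: sum.distrib)
  also have "\<dots> \<le> (\<Sum>j\<in>{0..<int (length w)}. length (w ! nat j))"
    by (intro sum_mono order_trans[OF card_mono card_length]) auto
  also have "\<dots> = (\<Sum>i\<in>{0..<length w}. length (w ! i))"
    by (rule sum.reindex_bij_witness[of _ int nat]) auto
  also have "\<dots> = length (concat w)"
    by (simp add: length_concat sum_list_sum_nth)
  finally show ?thesis .
qed

lemma covering_word_imp_covering:
  assumes "covering_word S Z w"
  shows "covering S (int (length w)) (set Z) (word_set w)"
  unfolding covering_def
proof (intro conjI allI impI)
  fix a j assume "(a, j mod int (length w)) \<notin> set Z"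
  moreover have "j mod int (length w) \<in> set [0..int (length w) - 1]" "a \<in> set [Left, Right]"
    using assms by (auto simp: covering_word_def intro: side.exhaust)
  ultimately obtain b i where
      "(b, i) \<in> set (closed_nbrs S (int (length w)) (a, j mod int (length w)))"
      "b \<in> set (w ! nat i)"
    using assms unfolding covering_word_def by blast
  moreover from this(1) have "i mod int (length w) = i" by auto
  ultimately have "covers (closed_nbrs S (int (length w))) (word_set w) (a, j mod int (length w))"
    unfolding covers_def by (force simp: word_set_def)
  then show "covered S (word_set w) (a, j)"
    by (simp only: covers_iff_coverage coverage_eq_unrolled[OF periodic_word_set]
      coverage_mod[OF periodic_word_set])
qed (rule periodic_word_set)

lemma word_set_prefix:
  assumes "0 \<le> j" "j < int (length v)"
  shows "(a, j) \<in> word_set (v @ w) \<longleftrightarrow> a \<in> set (v ! nat j)"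
  using assms by (simp add: word_set_def nth_append nat_less_iff)

lemma word_set_suffix:
  assumes "- int (length w) \<le> j" "j < 0"
  shows "(a, j) \<in> word_set (v @ w) \<longleftrightarrow> a \<in> set (w ! nat (j + int (length w)))"
proof -
  let ?n = "int (length (v @ w))"
  have "j mod ?n = (j + ?n) mod ?n" by simp
  also have "\<dots> = j + ?n" using assms by (intro mod_pos_pos_trivial) auto
  finally have "nat (j mod ?n) = length v + nat (j + int (length w))" using assms by simp
  then show ?thesis by (simp add: word_set_def nth_append)
qed

lemma length_pumped: "length (pumped u p t k) = length u + k * length p + length t"
  by (simp add: pumped_def length_concat sum_list_replicate)

lemma word_set_pumped_Suc:
  assumes "- int (length t + k * length p) \<le> j" "j < int (length u + k * length p)"
  shows "(a, j) \<in> word_set (pumped u p t (Suc k)) \<longleftrightarrow> (a, j) \<in> word_set (pumped u p t k)"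
proof (cases "0 \<le> j")
  case True
  have "pumped u p t (Suc k) = (u @ concat (replicate k p)) @ (p @ t)"
    "pumped u p t k = (u @ concat (replicate k p)) @ t"
    by (simp_all add: pumped_def flip: replicate_append_same)
  then show ?thesis
    using word_set_prefix[OF True, of "u @ concat (replicate k p)"] assms(2)
    by (simp add: length_concat sum_list_replicate)
next
  case False
  have "pumped u p t (Suc k) = (u @ p) @ (concat (replicate k p) @ t)"
    "pumped u p t k = u @ (concat (replicate k p) @ t)"
    by (simp_all add: pumped_def)
  then show ?thesis
    using False assms(1)
    by (simp only:) (subst (1 2) word_set_suffix; simp add: length_concat sum_list_replicate)
qed

lemma mod_representative:
  fixes m lo j :: int
  assumes "0 < m"
  obtains i where "i mod m = j mod m" "lo \<le> i" "i < lo + m"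
proof (rule that)
  show "(lo + (j - lo) mod m) mod m = j mod m" by (simp add: mod_add_right_eq)
qed (use assms in simp_all)

lemma covered_cong_window:
  assumes "set S \<subseteq> {0..l}" "0 \<le> l"
    and "\<And>b x. \<bar>x - i\<bar> \<le> l \<Longrightarrow> (b, x) \<in> D \<longleftrightarrow> (b, x) \<in> D'"
  shows "covered S D (a, i) \<longleftrightarrow> covered S D' (a, i)"
proof -
  have "d \<in> D \<longleftrightarrow> d \<in> D'" if "d \<in> set (closed_nbrs S 0 (a, i))" for d
    using that assms by (cases a) (auto simp: subset_iff)
  then show ?thesis unfolding covers_def by blast
qed

text \<open>Every window of the longer word occurs in the shorter one.\<close>

lemma covering_pumped_Suc:
  fixes u p t :: "side list list" and k l :: nat
  defines "M \<equiv> \<lambda>k. int (length (pumped u p t k))"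
  assumes "set S \<subseteq> {0..int l}" "Z \<subseteq> UNIV \<times> {0}" "u \<noteq> []" "length p + 2 * l \<le> k * length p"
    and "covering S (M k) Z (word_set (pumped u p t k))"
  shows "covering S (M (Suc k)) Z (word_set (pumped u p t (Suc k)))"
  unfolding covering_def
proof (intro conjI allI impI)
  show periodic: "periodic (M (Suc k)) (word_set (pumped u p t (Suc k)))"
    unfolding M_def by (rule periodic_word_set)
  fix a j assume j: "(a, j mod M (Suc k)) \<notin> Z"
  define lo hi where "lo = - int (length t + k * length p)" and "hi = int (length u + k * length p)"
  have M: "M k = hi - lo - int (k * length p)" "M (Suc k) = M k + int (length p)"
    "0 < int (length u)"
    using assms(4) by (simp_all add: M_def lo_def hi_def length_pumped algebra_simps)
  have "0 < M (Suc k)"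
    using assms(4) by (simp add: M_def pumped_def del: length_append)
  then obtain i where i: "i mod M (Suc k) = j mod M (Suc k)"
      "lo + int l \<le> i" "i < lo + int l + M (Suc k)"
    by (rule mod_representative)
  have "int (length p) + 2 * int l \<le> int (k * length p)"
    using assms(5) by linarith
  with i(3) have i_hi: "i + int l < hi"
    unfolding M by linarith
  have "(a, i mod M k) \<notin> Z"
  proof
    assume Z: "(a, i mod M k) \<in> Z"
    have "\<bar>i\<bar> < M k"
      using i(2) i_hi M(3) unfolding M(1) lo_def hi_def by linarith
    moreover have "i mod M k = 0" using Z assms(3) by auto
    ultimately have "i = 0" using zdvd_imp_le[of "M k" "\<bar>i\<bar>"] by (auto simp: mod_eq_0_iff_dvd)
    with Z j i(1) show False by simp
  qed
  then have "covered S (word_set (pumped u p t k)) (a, i)"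
    using assms(6) by (simp add: covering_def)
  moreover have same: "(b, x) \<in> word_set (pumped u p t (Suc k))
      \<longleftrightarrow> (b, x) \<in> word_set (pumped u p t k)"
    if "\<bar>x - i\<bar> \<le> int l" for b x
    using that i(2) i_hi by (intro word_set_pumped_Suc) (simp_all add: lo_def hi_def)
  ultimately have "covered S (word_set (pumped u p t (Suc k))) (a, i)"
    using covered_cong_window[OF assms(2) _ same] by simp
  then show "covered S (word_set (pumped u p t (Suc k))) (a, j)"
    using covered_mod[OF periodic] i(1) by metis
qed

lemma covering_pumped:
  fixes u p t :: "side list list" and k l K :: nat
  assumes "set S \<subseteq> {0..int l}" "set Z \<subseteq> UNIV \<times> {0}" "u \<noteq> []" "length p + 2 * l \<le> K * length p"
    and "\<forall>i\<in>set [0..<Suc K]. covering_word S Z (pumped u p t i)"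
  shows "covering S (int (length (pumped u p t k))) (set Z) (word_set (pumped u p t k))"
proof -
  have base: "covering S (int (length (pumped u p t i))) (set Z) (word_set (pumped u p t i))"
    if "i \<le> K" for i
    using assms(5) that by (intro covering_word_imp_covering) (simp del: upt_Suc)
  show ?thesis
  proof (induction k)
    case 0
    show ?case by (rule base) simp
  next
    case (Suc k)
    show ?case
    proof (cases "Suc k \<le> K")
      case True
      then show ?thesis by (rule base)
    next
      case False
      then have "K * length p \<le> k * length p" by (intro mult_le_mono1) simp
      then have "length p + 2 * l \<le> k * length p" by (rule order_trans[OF assms(4)])
      then show ?thesis by (rule covering_pumped_Suc[OF assms(1-3) _ Suc.IH])
    qed
  qed
qed

lemma length_concat_pumped:
  "length (concat (pumped u p t k)) = length (concat u) + k * length (concat p) + length (concat t)"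
proof -
  have "length (concat (concat (replicate k p))) = k * length (concat p)"
    by (induction k) simp_all
  then show ?thesis by (simp add: pumped_def)
qed

lemma gamma_critical_wordI:
  assumes "0 < m" "length w = m" "length (concat w) = k"
    and "covering (offsets \<Delta>) (int m) {(Left, 0)} (word_set w)"
    and "\<And>D. covering (offsets \<Delta>) (int m) {} D \<Longrightarrow> k < weight (int m) D"
  shows "gamma_critical (knodel_vertices (2 * m)) (knodel_adj \<Delta> (2 * m))"
proof -
  have m: "2 \<le> 2 * m" "period (2 * m) = int m" using assms(1) by simp_all
  have weight: "weight (int m) (word_set w) \<le> k" using weight_word_set_le[of w] assms(2,3) by simp
  then have "\<not> covering (offsets \<Delta>) (int m) {} (word_set w)" using assms(5) by (meson leD)
  with assms(4) have "hole (offsets \<Delta>) (int m) (word_set w)" by (rule hole_if_not_covering)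
  moreover have "k < domination_number (knodel_vertices (2 * m)) (knodel_adj \<Delta> (2 * m))"
    using assms(5) domination_number_knodel_le_iff[OF m(1)] unfolding m(2)
    by (meson leD not_le_imp_less)
  ultimately show ?thesis
    unfolding gamma_critical_knodel_iff[OF m(1)] m(2) using weight by (meson order_le_less_trans)
qed

lemma not_gamma_critical_wordI:
  assumes "0 < m" "length w = m" "length (concat w) = k"
    and "covering (offsets \<Delta>) (int m) {} (word_set w)"
    and "\<And>D. hole (offsets \<Delta>) (int m) D \<Longrightarrow> k \<le> weight (int m) D"
  shows "\<not> gamma_critical (knodel_vertices (2 * m)) (knodel_adj \<Delta> (2 * m))"
proof -
  have m: "2 \<le> 2 * m" "period (2 * m) = int m" using assms(1) by simp_all
  have "weight (int m) (word_set w) \<le> k" using weight_word_set_le[of w] assms(2,3) by simp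
  with assms(4) have "domination_number (knodel_vertices (2 * m)) (knodel_adj \<Delta> (2 * m)) \<le> k"
    unfolding domination_number_knodel_le_iff[OF m(1)] m(2) by blast
  then show ?thesis
    using assms(5) unfolding gamma_critical_knodel_iff[OF m(1)] m(2) by (meson leD order_trans)
qed

section \<open>The 4-regular case: lower bounds\<close>

abbreviation shifts :: "int list" where
  "shifts \<equiv> [0, 1, 3, 7]"

lemma offsets_4: "offsets 4 = shifts"
  by (simp add: offsets_def numeral_eq_Suc)

text \<open>The lemma names record the excess budgets that do not suffice. The centres and radii of the
  windows were found by experiment.\<close>

lemma covering_excess_3_0:
  assumes "m = 11 \<or> 13 \<le> m" "covering shifts m {} D" "m < 5 * int (side_weight m D a)"
  shows "3 < side_excess shifts m D (opposite a) \<or> 0 < side_excess shifts m D a"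
proof -
  have "no_close_pair shifts 11 0 4 11 3 0" "no_close_pair shifts 0 (-5) (-2) 6 3 0"
    by code_simp+
  moreover have "fits shifts m 11 11 \<or> fits shifts m 0 6" using assms(1) by (auto simp: fits_def)
  ultimately obtain m' x y r where "no_close_pair shifts m' x y r 3 0" "fits shifts m m' r" by blast
  from no_close_pair_excess[OF this assms(2), of a] assms(3) show ?thesis by simp
qed

lemma covering_excess_2_5:
  assumes "m = 19 \<or> m = 24 \<or> 29 \<le> m" "covering shifts m {} D" "m < 5 * int (side_weight m D a)"
  shows "2 < side_excess shifts m D (opposite a) \<or> 5 < side_excess shifts m D a"
proof -
  have "no_close_pair shifts 19 (-1) 0 19 2 5" "no_close_pair shifts 24 (-1) 0 24 2 5"
    "no_close_pair shifts 0 (-4) (-1) 14 2 5"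
    by code_simp+
  moreover have "fits shifts m 19 19 \<or> fits shifts m 24 24 \<or> fits shifts m 0 14"
    using assms(1) by (auto simp: fits_def)
  ultimately obtain m' x y r where "no_close_pair shifts m' x y r 2 5" "fits shifts m m' r" by blast
  from no_close_pair_excess[OF this assms(2), of a] assms(3) show ?thesis by simp
qed

lemma covering_13_excess_2_2:
  assumes "covering shifts 13 {} D" "13 < 5 * int (side_weight 13 D a)"
  shows "2 < side_excess shifts 13 D (opposite a) \<or> 2 < side_excess shifts 13 D a"
proof -
  have "no_close_pair shifts 13 8 2 13 2 2" by code_simp
  moreover have "fits shifts 13 13 13" by (simp add: fits_def)
  ultimately show ?thesis
    using no_close_pair_excess[OF _ _ assms(1), of 13 8 2 13 2 2 a] assms(2) by simp
qed

lemma hole_excess_0_2: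
  assumes "m = 12 \<or> 15 \<le> m" "hole shifts m D"
  shows "0 < side_excess shifts m D Left \<or> 2 < side_excess shifts m D Right"
proof -
  have "no_hole shifts 12 6 7 12 0 2" "no_hole shifts 0 2 6 7 0 2" by code_simp+
  moreover have "fits shifts m 12 12 \<and> m = 12 \<or> fits shifts m 0 7 \<and> \<bar>2\<bar> + 7 < m"
    using assms(1) by (auto simp: fits_def)
  ultimately obtain m' x y r where "no_hole shifts m' x y r 0 2" "fits shifts m m' r"
      "m' = m \<or> \<bar>x\<bar> + r < m"
    by blast
  then show ?thesis using no_hole_excess[OF _ hole_periodic[OF assms(2)] _ assms(2)] by blast
qed

lemma hole_excess_0_5:
  assumes "23 \<le> m" "hole shifts m D"
  shows "0 < side_excess shifts m D Left \<or> 5 < side_excess shifts m D Right"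
proof -
  have "no_hole shifts 0 4 7 11 0 5" by code_simp
  moreover have "fits shifts m 0 11" "\<bar>4\<bar> + 11 < m" using assms(1) by (simp_all add: fits_def)
  ultimately show ?thesis using no_hole_excess[OF _ hole_periodic[OF assms(2)] _ assms(2)] by blast
qed

lemma hole_excess_3_2:
  assumes "m = 23 \<or> 27 \<le> m" "hole shifts m D"
  shows "3 < side_excess shifts m D Left \<or> 2 < side_excess shifts m D Right"
proof -
  have "no_hole shifts 23 0 2 23 3 2" "no_hole shifts 0 1 3 13 3 2" by code_simp+
  moreover have "fits shifts m 23 23 \<and> m = 23 \<or> fits shifts m 0 13 \<and> \<bar>1\<bar> + 13 < m"
    using assms(1) by (auto simp: fits_def)
  ultimately obtain m' x y r where "no_hole shifts m' x y r 3 2" "fits shifts m m' r"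
      "m' = m \<or> \<bar>x\<bar> + r < m"
    by blast
  then show ?thesis using no_hole_excess[OF _ hole_periodic[OF assms(2)] _ assms(2)] by blast
qed

lemma hole_14_excess_2_1:
  assumes "hole shifts 14 D"
  shows "2 < side_excess shifts 14 D Left \<or> 1 < side_excess shifts 14 D Right"
proof -
  have "no_hole shifts 14 1 2 14 2 1" by code_simp
  moreover have "fits shifts 14 14 14" by (simp add: fits_def)
  ultimately show ?thesis using no_hole_excess[OF _ hole_periodic[OF assms] _ assms] by blast
qed

lemma side_excess_covering_shifts:
  assumes "covering shifts (int m) {} D" "0 < m"
  shows "int (side_excess shifts (int m) D a) + int m
    = int (side_weight (int m) D a) + 4 * int (side_weight (int m) D (opposite a))"
  using side_excess_covering[OF _ assms(1), of a] assms(2) by simp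

lemma side_excess_hole_shifts:
  assumes "hole shifts (int m) D" "0 < m"
  shows "int (side_excess shifts (int m) D Left) + int m
      = int (side_weight (int m) D Left) + 4 * int (side_weight (int m) D Right) + 1"
    "int (side_excess shifts (int m) D Right) + int m
      = int (side_weight (int m) D Right) + 4 * int (side_weight (int m) D Left)"
  using side_excess_hole[OF _ assms(1), of Left] side_excess_hole[OF _ assms(1), of Right] assms(2)
  by simp_all

lemma covering_weight_1_mod_5:
  assumes "m = 5 * q + 1" "2 \<le> q" "covering shifts (int m) {} D"
  shows "2 * q + 1 < weight (int m) D"
proof (rule ccontr)
  let ?w = "side_weight (int m) D"
  assume "\<not> ?thesis"
  then have small: "?w Left + ?w Right \<le> 2 * q + 1" by (simp add: weight_def)
  have excess: "int (side_excess shifts (int m) D a) + int m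
      = int (?w a) + 4 * int (?w (opposite a))" for a
    using side_excess_covering_shifts[OF assms(3)] assms(1) by simp
  have "?w Left = q \<and> ?w Right = q + 1 \<or> ?w Left = q + 1 \<and> ?w Right = q"
    using excess[of Left] excess[of Right] small assms(1) by simp arith
  then obtain a where w: "?w a = q + 1" "?w (opposite a) = q" by (metis opposite.simps)
  have "int m = 11 \<or> 13 \<le> int m" using assms(1,2) by presburger
  then have "3 < side_excess shifts (int m) D (opposite a) \<or> 0 < side_excess shifts (int m) D a"
    using assms(1) w by (intro covering_excess_3_0[OF _ assms(3)]) simp_all
  then show False using excess[of a] excess[of "opposite a"] w assms(1) by simp
qed

lemma covering_weight_13:
  assumes "covering shifts 13 {} D"
  shows "6 < weight 13 D"
proof (rule ccontr)
  assume small: "\<not> ?thesis"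
  have excess: "int (side_excess shifts 13 D a) + 13
      = int (side_weight 13 D a) + 4 * int (side_weight 13 D (opposite a))" for a
    using side_excess_covering_shifts[of 13 D a] assms by simp
  have w: "side_weight 13 D Left = 3" "side_weight 13 D Right = 3"
    using excess[of Left] excess[of Right] small by (simp_all add: weight_def)
  then show False
    using covering_13_excess_2_2[OF assms, of Left] excess[of Left] excess[of Right] by simp
qed

lemma covering_weight_4_mod_5:
  assumes "m = 5 * q + 4" "3 \<le> q" "covering shifts (int m) {} D"
  shows "2 * q + 3 < weight (int m) D"
proof (rule ccontr)
  let ?w = "side_weight (int m) D"
  assume "\<not> ?thesis"
  then have small: "?w Left + ?w Right \<le> 2 * q + 3" by (simp add: weight_def)
  have excess: "int (side_excess shifts (int m) D a) + int m
      = int (?w a) + 4 * int (?w (opposite a))" for a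
    using side_excess_covering_shifts[OF assms(3)] assms(1) by simp
  have "q + 1 \<le> ?w Left" "q + 1 \<le> ?w Right"
    using excess[of Left] excess[of Right] small assms(1) by simp_all
  with small have "?w Left = q + 1 \<and> ?w Right \<le> q + 2 \<or> ?w Right = q + 1 \<and> ?w Left \<le> q + 2"
    by arith
  then obtain a where w: "?w a = q + 1" "?w (opposite a) \<le> q + 2" by (metis opposite.simps)
  have "int m = 19 \<or> int m = 24 \<or> 29 \<le> int m" using assms(1,2) by presburger
  then have "2 < side_excess shifts (int m) D (opposite a) \<or> 5 < side_excess shifts (int m) D a"
    using assms(1) w by (intro covering_excess_2_5[OF _ assms(3)]) simp_all
  then show False using excess[of a] excess[of "opposite a"] w assms(1) by auto
qed

lemma hole_weight_0_mod_5:
  assumes "m = 5 * q" "0 < q" "hole shifts (int m) D"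
  shows "2 * q \<le> weight (int m) D"
  using side_excess_hole_shifts[OF assms(3)] assms(1,2) by (simp add: weight_def)

lemma hole_weight_2_mod_5:
  assumes "m = 5 * q + 2" "2 \<le> q" "hole shifts (int m) D"
  shows "2 * q + 2 \<le> weight (int m) D"
proof (rule ccontr)
  let ?w = "side_weight (int m) D"
  assume "\<not> ?thesis"
  then have small: "?w Left + ?w Right \<le> 2 * q + 1" by (simp add: weight_def)
  have "0 < m" using assms(1) by simp
  note excess = side_excess_hole_shifts[OF assms(3) this]
  have "?w Left = q + 1" "?w Right = q" using excess small assms(1) by simp_all
  moreover have "int m = 12 \<or> 15 \<le> int m" using assms(1,2) by presburger
  ultimately show False using hole_excess_0_2[OF _ assms(3)] excess assms(1) by auto
qed

lemma hole_weight_14: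
  assumes "hole shifts 14 D"
  shows "7 \<le> weight 14 D"
proof (rule ccontr)
  assume small: "\<not> ?thesis"
  note excess = side_excess_hole_shifts[of 14 D, simplified, OF assms]
  have "side_weight 14 D Left = 3" "side_weight 14 D Right = 3"
    using excess small by (simp_all add: weight_def)
  then show False using hole_14_excess_2_1[OF assms] excess by simp
qed

lemma hole_weight_3_mod_5:
  assumes "m = 5 * q + 3" "4 \<le> q" "hole shifts (int m) D"
  shows "2 * q + 3 \<le> weight (int m) D"
proof (rule ccontr)
  let ?w = "side_weight (int m) D"
  assume "\<not> ?thesis"
  then have small: "?w Left + ?w Right \<le> 2 * q + 2" by (simp add: weight_def)
  have "0 < m" using assms(1) by simp
  note excess = side_excess_hole_shifts[OF assms(3) this]
  have "?w Left = q + 2 \<and> ?w Right = q \<or> ?w Left = q + 1 \<and> ?w Right = q + 1"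
    using excess small assms(1) by simp arith
  moreover have "int m = 23 \<or> 27 \<le> int m" using assms(1,2) by presburger
  ultimately show False
    using hole_excess_0_5[OF _ assms(3)] hole_excess_3_2[OF _ assms(3)] excess assms(1) by auto
qed

section \<open>The 4-regular case: coverings\<close>

lemma covering_pumped_offsets_4:
  assumes "\<forall>i\<in>set [0..<5]. covering_word shifts zs (pumped u p t i)"
    and "Z = set zs" "Z \<subseteq> UNIV \<times> {0}" "u \<noteq> []" "length p = 5" "length (pumped u p t k) = m"
  shows "covering (offsets 4) (int m) Z (word_set (pumped u p t k))"
  unfolding offsets_4 assms(2) assms(6)[symmetric]
  by (rule covering_pumped[where l = 7 and K = 4]) (use assms in \<open>simp_all add: numeral_eq_Suc\<close>)

lemma gamma_critical_1_mod_5: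
  assumes "m = 5 * q + 1" "2 \<le> q"
  shows "gamma_critical (knodel_vertices (2 * m)) (knodel_adj 4 (2 * m))"
proof (rule gamma_critical_wordI)
  let ?w = "pumped [[], [], [Right], [Left], [Left], [], [], [], [Right], [Left]]
    [[], [], [], [Right], [Left]] [[]]"
  show length: "length (?w (q - 2)) = m" using assms by (simp add: length_pumped)
  show "length (concat (?w (q - 2))) = 2 * q + 1" using assms by (simp add: length_concat_pumped)
  have "\<forall>i\<in>set [0..<5]. covering_word shifts [(Left, 0)] (?w i)"
    by code_simp
  then show "covering (offsets 4) (int m) {(Left, 0)} (word_set (?w (q - 2)))"
    by (rule covering_pumped_offsets_4) (use length in simp_all)
qed (use assms covering_weight_1_mod_5[OF assms] in \<open>auto simp: offsets_4\<close>)

lemma gamma_critical_4_mod_5: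
  assumes "m = 5 * q + 4" "3 \<le> q"
  shows "gamma_critical (knodel_vertices (2 * m)) (knodel_adj 4 (2 * m))"
proof (rule gamma_critical_wordI)
  let ?w = "pumped [[], [Left], [Left], [], [], [], [Right], [Left], [], [], []]
    [[Right], [Left], [], [], []] [[Left, Right], [Left], [], [], [], [Right], [Right], []]"
  show length: "length (?w (q - 3)) = m" using assms by (simp add: length_pumped)
  show "length (concat (?w (q - 3))) = 2 * q + 3" using assms by (simp add: length_concat_pumped)
  have "\<forall>i\<in>set [0..<5]. covering_word shifts [(Left, 0)] (?w i)"
    by code_simp
  then show "covering (offsets 4) (int m) {(Left, 0)} (word_set (?w (q - 3)))"
    by (rule covering_pumped_offsets_4) (use length in simp_all)
qed (use assms covering_weight_4_mod_5[OF assms] in \<open>auto simp: offsets_4\<close>)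

lemma not_gamma_critical_0_mod_5:
  assumes "m = 5 * q" "2 \<le> q"
  shows "\<not> gamma_critical (knodel_vertices (2 * m)) (knodel_adj 4 (2 * m))"
proof (rule not_gamma_critical_wordI)
  let ?p = "[[Left], [], [], [], [Right]]"
  let ?w = "pumped (?p @ ?p) ?p []"
  show length: "length (?w (q - 2)) = m" using assms by (simp add: length_pumped)
  show "length (concat (?w (q - 2))) = 2 * q" using assms by (simp add: length_concat_pumped)
  have "\<forall>i\<in>set [0..<5]. covering_word shifts [] (?w i)"
    by code_simp
  then show "covering (offsets 4) (int m) {} (word_set (?w (q - 2)))"
    by (rule covering_pumped_offsets_4) (use length in simp_all)
qed (use assms hole_weight_0_mod_5[of m q] in \<open>auto simp: offsets_4\<close>)

lemma not_gamma_critical_2_mod_5: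
  assumes "m = 5 * q + 2" "2 \<le> q"
  shows "\<not> gamma_critical (knodel_vertices (2 * m)) (knodel_adj 4 (2 * m))"
proof (rule not_gamma_critical_wordI)
  let ?p = "[[Left], [], [], [], [Right]]"
  let ?w = "pumped ([[Left], [], [Right], [], [Right]] @ ?p) ?p [[Left], []]"
  show length: "length (?w (q - 2)) = m" using assms by (simp add: length_pumped)
  show "length (concat (?w (q - 2))) = 2 * q + 2" using assms by (simp add: length_concat_pumped)
  have "\<forall>i\<in>set [0..<5]. covering_word shifts [] (?w i)"
    by code_simp
  then show "covering (offsets 4) (int m) {} (word_set (?w (q - 2)))"
    by (rule covering_pumped_offsets_4) (use length in simp_all)
qed (use assms hole_weight_2_mod_5[OF assms] in \<open>auto simp: offsets_4\<close>)

lemma not_gamma_critical_3_mod_5: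
  assumes "m = 5 * q + 3" "4 \<le> q"
  shows "\<not> gamma_critical (knodel_vertices (2 * m)) (knodel_adj 4 (2 * m))"
proof (rule not_gamma_critical_wordI)
  let ?p = "[[Right], [Left], [], [], []]"
  let ?w = "pumped ([[Left], [], [Right], [], [Left], [Left], [Left], [], [], []] @ ?p) ?p
    [[Right], [Left], []]"
  show length: "length (?w (q - 3)) = m" using assms by (simp add: length_pumped)
  show "length (concat (?w (q - 3))) = 2 * q + 3" using assms by (simp add: length_concat_pumped)
  have "\<forall>i\<in>set [0..<5]. covering_word shifts [] (?w i)"
    by code_simp
  then show "covering (offsets 4) (int m) {} (word_set (?w (q - 3)))"
    by (rule covering_pumped_offsets_4) (use length in simp_all)
qed (use assms hole_weight_3_mod_5[OF assms] in \<open>auto simp: offsets_4\<close>)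

lemma gamma_critical_26: "gamma_critical (knodel_vertices 26) (knodel_adj 4 26)"
proof -
  let ?w = "[[], [Left], [Left], [], [], [], [Left], [], [], [], [Right], [Right], [Right]]"
  have "covering_word shifts [(Left, 0)] ?w" by code_simp
  from covering_word_imp_covering[OF this] show ?thesis
    using gamma_critical_wordI[of 13 ?w 6 4] covering_weight_13 by (simp add: offsets_4)
qed

lemma not_gamma_critical_short_word:
  assumes "covering_word shifts [] w" "length w = m" "length (concat w) = k"
    and "\<And>D. hole shifts (int m) D \<Longrightarrow> k \<le> weight (int m) D"
  shows "\<not> gamma_critical (knodel_vertices (2 * m)) (knodel_adj 4 (2 * m))"
proof (rule not_gamma_critical_wordI[OF _ assms(2,3)])
  show "0 < m" using assms(1,2) unfolding covering_word_def by blast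
  show "covering (offsets 4) (int m) {} (word_set w)"
    using covering_word_imp_covering[OF assms(1)] assms(2) by (simp add: offsets_4)
qed (use assms(4) in \<open>simp add: offsets_4\<close>)

lemma not_gamma_critical_small:
  assumes "n = 16 \<or> n = 18 \<or> n = 28 \<or> n = 36"
  shows "\<not> gamma_critical (knodel_vertices n) (knodel_adj 4 n)"
proof -
  let ?w8 = "[[Left], [], [Right], [Left], [], [Right], [], []]"
    and ?w9 = "[[Left], [], [], [], [Right], [Right], [], [], [Left]]"
    and ?w14 = "[[Left], [], [Right], [Left], [], [], [Left],
      [], [Right], [], [], [Right], [Left], []]"
  have words: "covering_word shifts [] ?w8" "covering_word shifts [] ?w9"
    "covering_word shifts [] ?w14" "covering_word shifts [] (?w9 @ ?w9)"
    by code_simp+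
  have "4 \<le> weight 8 D" if "hole shifts 8 D" for D
    using side_excess_hole_shifts[of 8 D] that by (simp add: weight_def; arith)
  moreover have "4 \<le> weight 9 D" if "hole shifts 9 D" for D
    using side_excess_hole_shifts[of 9 D] that by (simp add: weight_def)
  moreover have "8 \<le> weight 18 D" if "hole shifts 18 D" for D
    using side_excess_hole_shifts[of 18 D] that by (simp add: weight_def; arith)
  ultimately show ?thesis
    using assms hole_weight_14
      not_gamma_critical_short_word[OF words(1), of 8 4]
      not_gamma_critical_short_word[OF words(2), of 9 4]
      not_gamma_critical_short_word[OF words(3), of 14 7]
      not_gamma_critical_short_word[OF words(4), of 18 8]
    by auto
qed

theorem theorem4p5:
  fixes n :: nat
  assumes "even n" and "n \<ge> 16"
  shows "gamma_critical (knodel_vertices n) (knodel_adj 4 n) \<longleftrightarrow>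
           (n = 26 \<or> (n \<ge> 22 \<and> n mod 10 = 2) \<or> (n \<ge> 38 \<and> n mod 10 = 8))"
    (is "?critical \<longleftrightarrow> ?residues")
proof -
  obtain m where n: "n = 2 * m" using assms(1) by (rule evenE)
  define q where "q = m div 5"
  consider
    (critical) "m = 5 * q + 1 \<and> 2 \<le> q \<or> m = 5 * q + 4 \<and> 3 \<le> q \<or> n = 26"
  | (not_critical) "m = 5 * q \<and> 2 \<le> q \<or> m = 5 * q + 2 \<and> 2 \<le> q \<or> m = 5 * q + 3 \<and> 4 \<le> q
      \<or> n = 16 \<or> n = 18 \<or> n = 28 \<or> n = 36"
    unfolding q_def n using assms(2) n by atomize_elim presburger
  then show ?thesis
  proof cases
    case critical
    then have ?critical
      using gamma_critical_1_mod_5[of m q] gamma_critical_4_mod_5[of m q] gamma_critical_26 n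
      by metis
    moreover have ?residues using critical n by (elim disjE conjE; presburger)
    ultimately show ?thesis by blast
  next
    case not_critical
    then have "\<not> ?critical"
      using not_gamma_critical_0_mod_5[of m q] not_gamma_critical_2_mod_5[of m q]
        not_gamma_critical_3_mod_5[of m q] not_gamma_critical_small[of n] n
      by metis
    moreover have "\<not> ?residues" using not_critical n by (elim disjE conjE; presburger)
    ultimately show ?thesis by blast
  qed
qed

end
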